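(* Let $A=(a_1,\dots,a_p)$ and $B=(b_1,\dots,b_p)$ be in $\mathbb{N}^p$ such that $(A,B)$ is a suitable pair, and let $S=\langle C(A,B)\rangle$. Then \[ O(G(S))-E(G(S)) = \frac{\alpha\beta-1}{2}, \] where \[ \alpha = \prod_{i=m_2(B)}^{p} a_i \quad\text{and}\quad \beta=\prod_{i=1}^{M_2(A)} b_i . \]
   Context: $\mathbb{N}$ is the set of positive integers and $\mathbb{N}_0$ the set of nonnegative integers. A numerical semigroup $S$ is a submonoid of $(\mathbb{N}_0,+)$ with finite complement; $G(S)=\mathbb{N}_0\setminus S$ is its (finite) set of gaps. For a sequence of positive integers $(n_0,\dots,n_p)$, $\langle n_0,\dots,n_p\rangle$ is the set of all $\mathbb{N}_0$-linear combinations of its terms; it is a numerical semigroup iff $\gcd(n_0,\dots,n_p)=1$. Compound sequence: for $p\in\mathbb{N}_0$ and $A=(a_1,\dots,a_p),B=(b_1,\dots,b_p)\in\mathbb{N}^p$, $(A,B)$ is a suitable pair if $\gcd(a_i,b_j)=1$ for all $i\ge j$. Given a suitable pair, the compound sequence $C(A,B)=(n_0,\dots,n_p)$ is defined by $n_0=a_1a_2\cdots a_p$ and $n_i=n_{i-1}b_i/a_i$ for $1\le i\le p$ (so $n_i=b_1\cdots b_i a_{i+1}\cdots a_p$). No assumption $a_i<b_i$ or $a_i,b_i\geq 2$ is made. It is known that $\gcd(n_0,\dots,n_p)=1$, so $\langle C(A,B)\rangle$ is a numerical semigroup. For a sequence $Z=(z_1,\dots,z_p)$ of integers, $m_2(Z):=\min(\{1\le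 i\le p : z_i\text{ is even}\}\cup\{p+1\})$ and $M_2(Z):=\max(\{0\}\cup\{1\le i\le p : z_i\text{ is even}\})$. Empty products equal $1$. For a finite set $X$ of integers, $O(X)$ (resp. $E(X)$) is the number of odd (resp. even) integers in $X$. *)

theory Defs
  imports Complex_Main
begin

text \<open>A sequence \<open>(z\<^sub>1, \<dots>, z\<^sub>p)\<close> is represented by its length \<open>p\<close> and a function on \<open>nat\<close>
  of which only the values at \<open>1, \<dots>, p\<close> are ever used. The type \<open>nat\<close> plays the role of the
  nonnegative integers.\<close>

definition suitable_pair :: "nat \<Rightarrow> (nat \<Rightarrow> nat) \<Rightarrow> (nat \<Rightarrow> nat) \<Rightarrow> bool" where
  "suitable_pair p a b \<longleftrightarrow> (\<forall>i\<in>{1..p}. \<forall>j\<in>{1..p}. j \<le> i \<longrightarrow> gcd (a i) (b j) = 1)"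

text \<open>The term \<open>n\<^sub>i\<close> of the compound sequence, for \<open>i \<le> p\<close>. For positive \<open>a\<^sub>i\<close> the division is
  exact, by \<open>compound_seq_Suc_exact\<close> below.\<close>

primrec compound_seq :: "nat \<Rightarrow> (nat \<Rightarrow> nat) \<Rightarrow> (nat \<Rightarrow> nat) \<Rightarrow> nat \<Rightarrow> nat" where
  "compound_seq p a b 0 = (\<Prod>i=1..p. a i)"
| "compound_seq p a b (Suc i) = (compound_seq p a b i * b (Suc i)) div a (Suc i)"

lemma compound_seq_closed_form:
  assumes "\<And>k. k \<in> {1..p} \<Longrightarrow> 0 < a k" and "i \<le> p"
  shows "compound_seq p a b i = (\<Prod>k=1..i. b k) * (\<Prod>k=Suc i..p. a k)"
  using assms(2)
proof (induction i)
  case 0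
  show ?case by simp
next
  case (Suc i)
  have "(\<Prod>k=Suc i..p. a k) = a (Suc i) * (\<Prod>k=Suc (Suc i)..p. a k)"
    using Suc.prems by (simp add: prod.atLeast_Suc_atMost)
  then have "compound_seq p a b i * b (Suc i)
      = ((\<Prod>k=1..Suc i. b k) * (\<Prod>k=Suc (Suc i)..p. a k)) * a (Suc i)"
    using Suc by (simp add: mult_ac)
  moreover have "0 < a (Suc i)"
    using Suc.prems assms(1) by simp
  ultimately show ?case
    by (simp only: compound_seq.simps nonzero_mult_div_cancel_right)
qed

lemma compound_seq_Suc_exact:
  assumes "\<And>k. k \<in> {1..p} \<Longrightarrow> 0 < a k" and "i < p"
  shows "compound_seq p a b (Suc i) * a (Suc i) = compound_seq p a b i * b (Suc i)"
proof -
  have "(\<Prod>k=Suc i..p. a k) = a (Suc i) * (\<Prod>k=Suc (Suc i)..p. a k)"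
    using assms(2) by (simp add: prod.atLeast_Suc_atMost)
  then show ?thesis
    using compound_seq_closed_form[OF assms(1), where i = i]
      compound_seq_closed_form[OF assms(1), where i = "Suc i"] assms(2)
    by (simp add: mult_ac del: compound_seq.simps)
qed

definition generated_monoid :: "nat \<Rightarrow> (nat \<Rightarrow> nat) \<Rightarrow> nat set" where
  "generated_monoid p n = {x. \<exists>c :: nat \<Rightarrow> nat. x = (\<Sum>i=0..p. c i * n i)}"

definition gaps :: "nat set \<Rightarrow> nat set" where
  "gaps S = UNIV - S"

definition m2 :: "nat \<Rightarrow> (nat \<Rightarrow> 'a::semiring_parity) \<Rightarrow> nat" where
  "m2 p z = Min ({i. 1 \<le> i \<and> i \<le> p \<and> even (z i)} \<union> {p + 1})"

definition M2 :: "nat \<Rightarrow> (nat \<Rightarrow> 'a::semiring_parity) \<Rightarrow> nat" where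
  "M2 p z = Max ({0} \<union> {i. 1 \<le> i \<and> i \<le> p \<and> even (z i)})"

definition num_odd :: "'a::semiring_parity set \<Rightarrow> nat" where
  "num_odd X = card {x \<in> X. odd x}"

definition num_even :: "'a::semiring_parity set \<Rightarrow> nat" where
  "num_even X = card {x \<in> X. even x}"

end

theory Submission
  imports Defs "HOL-Computational_Algebra.Computational_Algebra" "HOL-Number_Theory.Cong"
begin

text \<open>For a set \<open>S\<close> with finitely many gaps, \<open>P\<^sub>S(x) = (1 - x) \<Sum>\<^bsub>s\<in>S\<^esub> x\<^sup>s = 1 - (1 - x) \<Sum>\<^bsub>g\<in>G(S)\<^esub> x\<^sup>g\<close>
  is a polynomial with \<open>P\<^sub>S(1) = 1\<close> and \<open>P\<^sub>S(-1) = 1 + 2 (O(G(S)) - E(G(S)))\<close>, so the claim is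
  \<open>P\<^sub>S(-1) = \<alpha> \<beta>\<close>. Removing the last terms \<open>a = a\<^sub>p\<close> and \<open>b\<^sub>p\<close> exhibits \<open>S\<close> as a gluing
  \<open>a T + n \<nat>\<^sub>0\<close>, where \<open>T\<close> is a shorter compound semigroup and \<open>n = b\<^sub>1 \<cdots> b\<^sub>p \<in> T\<close> is coprime to \<open>a\<close>.
  This gives \<open>P\<^sub>S(x) (1 - x\<^sup>a) (1 - x\<^sup>n) = (1 - x) (1 - x\<^bsup>an\<^esup>) P\<^sub>T(x\<^sup>a)\<close>. At \<open>x = -1\<close>, after cancelling
  the factor that vanishes there, \<open>P\<^sub>S(-1)\<close> is \<open>n\<close> if \<open>a\<close> is even, \<open>P\<^sub>T(-1)\<close> if both \<open>a\<close> and \<open>n\<close> are odd,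
  and \<open>a P\<^sub>T(-1)\<close> if \<open>n\<close> is even; the product \<open>\<alpha> \<beta>\<close> obeys the same recursion in \<open>p\<close>.\<close>

section \<open>Generating functions of semigroups and gluings\<close>

definition indicator_fps :: "nat set \<Rightarrow> real fps" where
  "indicator_fps S = Abs_fps (\<lambda>k. if k \<in> S then 1 else 0)"

text \<open>Built from the gaps so as to be a polynomial outright. A sum over an infinite set is 0
  by convention, so the link with \<open>S\<close> needs \<open>finite (gaps S)\<close>.\<close>

definition semigroup_poly :: "nat set \<Rightarrow> real poly" where
  "semigroup_poly S = 1 - (1 - monom 1 1) * (\<Sum>g\<in>gaps S. monom 1 g)"

definition gluing :: "nat \<Rightarrow> nat \<Rightarrow> nat set \<Rightarrow> nat set" where
  "gluing a n T = {a * t + n * c | t c. t \<in> T}"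

lemma fps_of_poly_semigroup_poly:
  assumes "finite (gaps S)"
  shows "fps_of_poly (semigroup_poly S) = (1 - fps_X) * indicator_fps S"
proof -
  have "indicator_fps S = indicator_fps UNIV - fps_of_poly (\<Sum>g\<in>gaps S. monom 1 g)"
    using assms by (auto simp: fps_eq_iff indicator_fps_def coeff_sum gaps_def)
  moreover have "(1 - fps_X) * indicator_fps UNIV = 1"
    by (auto simp: fps_eq_iff indicator_fps_def algebra_simps)
  ultimately show ?thesis
    by (simp add: semigroup_poly_def fps_of_poly_diff fps_of_poly_mult fps_of_poly_monom'
        right_diff_distrib)
qed

lemma poly_semigroup_poly_1: "poly (semigroup_poly S) 1 = 1"
  by (simp add: semigroup_poly_def poly_monom)

lemma poly_semigroup_poly_minus_1:
  assumes "finite (gaps S)"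
  shows "poly (semigroup_poly S) (-1) = 1 + 2 * (real (num_odd (gaps S)) - real (num_even (gaps S)))"
proof -
  let ?G = "gaps S"
  have "(\<Sum>g\<in>?G. (-1::real) ^ g) = (\<Sum>g\<in>?G. (if even g then 1 else 0) - (if odd g then 1 else 0))"
    by (intro sum.cong) auto
  also have "\<dots> = real (num_even ?G) - real (num_odd ?G)"
    using assms
    by (simp add: num_odd_def num_even_def sum_subtractf sum.If_cases Int_def)
  finally show ?thesis
    by (simp add: semigroup_poly_def poly_monom poly_sum)
qed

text \<open>Representations \<open>a * t + n * c\<close> are not unique, so the coefficients are
  compared through Apery sets. The factor 1 - X^n leaves the indicator of those \<open>k\<close> in
  the gluing with \<open>k - n\<close> outside it (\<open>P\<close> without \<open>Q\<close>); by
  coprimality these are exactly the elements of aT outside a(T + n) (\<open>P'\<close> without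
  \<open>Q'\<close>).\<close>

lemma indicator_fps_gluing:
  assumes "a > 0" "n > 0" "coprime a n" and closed: "\<forall>t\<in>T. t + n \<in> T"
  shows "indicator_fps (gluing a n T) * (1 - fps_X ^ n) =
    (indicator_fps T oo fps_X ^ a) * (1 - fps_X ^ (a * n))"
proof (rule fps_ext)
  fix k
  define P where "P \<longleftrightarrow> k \<in> gluing a n T"
  define Q where "Q \<longleftrightarrow> n \<le> k \<and> k - n \<in> gluing a n T"
  define P' where "P' \<longleftrightarrow> (\<exists>t\<in>T. k = a * t)"
  define Q' where "Q' \<longleftrightarrow> (\<exists>t\<in>T. k = a * (t + n))"
  have closed': "t + n * d \<in> T" if "t \<in> T" for t d
  proof (induction d)
    case (Suc d)
    then have "t + n * d + n \<in> T" using closed by blast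
    then show ?case by (simp add: add_ac)
  qed (use that in simp)
  have Q_iff: "Q \<longleftrightarrow> (\<exists>t\<in>T. \<exists>c. k = a * t + n * Suc c)"
  proof
    assume Q
    then obtain t c where "t \<in> T" "k - n = a * t + n * c" "n \<le> k"
      unfolding Q_def gluing_def by auto
    then have "k = a * t + n * Suc c" by simp
    with \<open>t \<in> T\<close> show "\<exists>t\<in>T. \<exists>c. k = a * t + n * Suc c" by blast
  next
    assume "\<exists>t\<in>T. \<exists>c. k = a * t + n * Suc c"
    then obtain t c where "t \<in> T" and "k = a * t + n * Suc c" by blast
    then have "n \<le> k" "k - n = a * t + n * c" by simp_all
    with \<open>t \<in> T\<close> show Q unfolding Q_def gluing_def by blast
  qed
  have QP: "Q \<longrightarrow> P" unfolding Q_iff P_def gluing_def by blast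
  have Q'P': "Q' \<longrightarrow> P'" unfolding P'_def Q'_def using closed by blast
  have "P' \<and> \<not> Q'" if "P" "\<not> Q"
  proof -
    obtain t c where tc: "t \<in> T" "k = a * t + n * c" using \<open>P\<close> unfolding P_def gluing_def by auto
    have "c = 0" using \<open>\<not> Q\<close> tc unfolding Q_iff by (cases c) blast+
    moreover have "\<not> Q'"
    proof
      assume Q'
      then obtain t' where t': "t' \<in> T" and "k = a * (t' + n)" unfolding Q'_def by auto
      \<comment> \<open>The summand \<open>a * n\<close> is read as \<open>a\<close> copies of
        \<open>n\<close>, at least one since \<open>a > 0\<close>; this is a representation of the
        kind excluded by the failure of \<open>Q\<close>.\<close>
      moreover have "Suc (a - 1) = a" using \<open>a > 0\<close> by simp
      ultimately have "k = a * t' + n * Suc (a - 1)" by (simp only: distrib_left mult.commute)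
      then show False using \<open>\<not> Q\<close> t' unfolding Q_iff by blast
    qed
    ultimately show ?thesis using tc unfolding P'_def by auto
  qed
  moreover have "P \<and> \<not> Q" if "P'" "\<not> Q'"
  proof
    obtain t where t: "t \<in> T" "k = a * t" using \<open>P'\<close> unfolding P'_def by auto
    have "k = a * t + n * 0" using t by simp
    then show P unfolding P_def gluing_def using t by blast
    show "\<not> Q"
    proof
      assume Q
      then obtain t' c where t': "t' \<in> T" "k = a * t' + n * Suc c" unfolding Q_iff by auto
      \<comment> \<open>By coprimality the number of copies of \<open>n\<close> is a positive
        multiple of \<open>a\<close>, so all of them can be moved into the element of
        \<open>T\<close>, leaving at least one \<open>n\<close> to witness
        \<open>Q'\<close>.\<close>
      then have "a dvd n * Suc c"
        using t dvd_add_right_iff[of a "a * t'" "n * Suc c"] by (metis dvd_triv_left)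
      then have "a dvd Suc c"
        using \<open>coprime a n\<close> by (simp add: coprime_dvd_mult_right_iff del: mult_Suc_right)
      then obtain d where d: "Suc c = a * d" by blast
      then obtain e where e: "d = Suc e" by (cases d) auto
      have "k = a * t' + n * (a * Suc e)" using t'(2) unfolding d e .
      also have "\<dots> = a * (t' + n * e + n)" by (simp add: algebra_simps)
      finally have "k = a * (t' + n * e + n)" .
      with closed'[OF t'(1)] have Q' unfolding Q'_def by blast
      then show False using \<open>\<not> Q'\<close> by simp
    qed
  qed
  ultimately have "P \<and> \<not> Q \<longleftrightarrow> P' \<and> \<not> Q'"
    by blast
  moreover have "of_bool P - of_bool Q = (of_bool (P \<and> \<not> Q) :: real)" using QP by (cases P) auto
  moreover have "of_bool P' - of_bool Q' = (of_bool (P' \<and> \<not> Q') :: real)" using Q'P' by (cases P') auto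
  ultimately have PQ: "of_bool P - of_bool Q = (of_bool P' - of_bool Q' :: real)"
    by simp
  \<comment> \<open>The left sides of this and the next equivalence are the forms in which the
    coefficients of the composition with X^a arise; \<open>a * n \<le> k\<close> guards the
    truncated subtraction.\<close>
  have P'_iff: "a dvd k \<and> k div a \<in> T \<longleftrightarrow> P'"
    using \<open>a > 0\<close> by (auto simp: P'_def)
  have Q'_iff: "a * n \<le> k \<and> a dvd (k - a * n) \<and> (k - a * n) div a \<in> T \<longleftrightarrow> Q'"
  proof
    assume L: "a * n \<le> k \<and> a dvd (k - a * n) \<and> (k - a * n) div a \<in> T"
    then obtain t where t: "k - a * n = a * t" by blast
    then have "t \<in> T" using L \<open>a > 0\<close> by simp
    moreover have "k = a * (t + n)" using t L unfolding distrib_left by linarith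
    ultimately show Q' unfolding Q'_def by blast
  next
    assume Q'
    then obtain t where "t \<in> T" "k = a * t + a * n" unfolding Q'_def by (auto simp: distrib_left)
    then show "a * n \<le> k \<and> a dvd (k - a * n) \<and> (k - a * n) div a \<in> T"
      using \<open>a > 0\<close> by simp
  qed
  have "(indicator_fps (gluing a n T) * (1 - fps_X ^ n)) $ k = of_bool P - of_bool Q"
    by (auto simp: P_def Q_def right_diff_distrib fps_X_power_mult_right_nth indicator_fps_def)
  moreover have "((indicator_fps T oo fps_X ^ a) * (1 - fps_X ^ (a * n))) $ k
      = of_bool (a dvd k \<and> k div a \<in> T)
        - of_bool (a * n \<le> k \<and> a dvd (k - a * n) \<and> (k - a * n) div a \<in> T)"
    using \<open>a > 0\<close>
    by (auto simp: right_diff_distrib fps_X_power_mult_right_nth indicator_fps_def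
        fps_nth_compose_X_power)
  ultimately show "(indicator_fps (gluing a n T) * (1 - fps_X ^ n)) $ k =
      ((indicator_fps T oo fps_X ^ a) * (1 - fps_X ^ (a * n))) $ k"
    using PQ unfolding P'_iff Q'_iff by simp
qed

text \<open>Every large \<open>x\<close> has the form \<open>a * t + n * c\<close>, where
  \<open>c < a\<close> solves n c = x modulo \<open>a\<close>. In the bound
  \<open>a * N + n * a\<close>, the second term pays for \<open>n * c\<close> and the first forces
  \<open>t\<close> beyond all gaps of \<open>T\<close>.\<close>

lemma finite_gaps_gluing:
  assumes "a > 0" "coprime a n" "finite (gaps T)"
  shows "finite (gaps (gluing a n T))"
proof -
  obtain N where N: "\<And>t. t \<in> gaps T \<Longrightarrow> t < N"
    using finite_nat_set_iff_bounded assms(3) by auto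
  have "x \<in> gluing a n T" if "a * N + n * a \<le> x" for x
  proof -
    obtain d where d: "[n * d = 1] (mod a)"
      using cong_solve_coprime_nat[of n a] assms(2) by (auto simp: coprime_commute)
    define c where "c = (d * x) mod a"
    have "[n * c = n * (d * x)] (mod a)"
      unfolding c_def by (intro cong_scalar_left) (simp add: cong_def)
    also have "[n * (d * x) = 1 * x] (mod a)"
      using cong_scalar_right[OF d] by (simp add: mult.assoc)
    finally have "[n * c = x] (mod a)" by simp
    moreover have "n * c \<le> n * a"
      unfolding c_def using assms(1) by (intro mult_left_mono) (auto intro: less_imp_le)
    moreover have "n * a \<le> x" using that by simp
    ultimately have "a dvd x - n * c"
      by (metis cong_altdef_nat cong_sym order_trans)
    then obtain t where t: "x - n * c = a * t" by blast
    then have x: "x = a * t + n * c" using \<open>n * c \<le> n * a\<close> \<open>n * a \<le> x\<close> by linarith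
    with that \<open>n * c \<le> n * a\<close> have "a * N \<le> a * t" by linarith
    then have "N \<le> t" using assms(1) by simp
    then have "t \<in> T" using N[of t] by (auto simp: gaps_def)
    with x show ?thesis unfolding gluing_def by blast
  qed
  then have "gaps (gluing a n T) \<subseteq> {..< a * N + n * a}"
    by (force simp: gaps_def not_less[symmetric])
  then show ?thesis using finite_subset by blast
qed

text \<open>The identity of indicator series is multiplied by (1 - X)(1 - X^a): the first factor
  completes the polynomial of the gluing, the second that of \<open>T\<close> at X^a.\<close>

lemma semigroup_poly_gluing:
  assumes "a > 0" "n > 0" "coprime a n" "finite (gaps T)" "\<forall>t\<in>T. t + n \<in> T"
  shows "semigroup_poly (gluing a n T) * (1 - monom 1 a) * (1 - monom 1 n) =
    (1 - monom 1 1) * (1 - monom 1 (a * n)) * (semigroup_poly T \<circ>\<^sub>p monom 1 a)"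
proof -
  have X0: "(fps_X ^ a :: real fps) $ 0 = 0" using assms(1) by simp
  have "fps_of_poly (semigroup_poly T \<circ>\<^sub>p monom 1 a) = ((1 - fps_X) * indicator_fps T) oo fps_X ^ a"
    using X0 assms(4)
    by (simp add: fps_of_poly_pcompose fps_of_poly_monom' fps_of_poly_semigroup_poly)
  also have "\<dots> = (1 - fps_X ^ a) * (indicator_fps T oo fps_X ^ a)"
    using X0 by (simp add: fps_compose_mult_distrib fps_compose_sub_distrib)
  finally have T: "fps_of_poly (semigroup_poly T \<circ>\<^sub>p monom 1 a) =
    (1 - fps_X ^ a) * (indicator_fps T oo fps_X ^ a)" .
  note G = indicator_fps_gluing[OF assms(1-3,5)]
  note S = fps_of_poly_semigroup_poly[OF finite_gaps_gluing[OF assms(1,3,4)]]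
  have "fps_of_poly (semigroup_poly (gluing a n T) * (1 - monom 1 a) * (1 - monom 1 n)) =
      (1 - fps_X) * (1 - fps_X ^ a) * (indicator_fps (gluing a n T) * (1 - fps_X ^ n))"
    by (simp only: S fps_of_poly_mult fps_of_poly_diff fps_of_poly_monom' fps_of_poly_1 mult_ac)
  also have "\<dots> = (1 - fps_X) * (1 - fps_X ^ a) * ((indicator_fps T oo fps_X ^ a) * (1 - fps_X ^ (a * n)))"
    by (simp only: G)
  also have "\<dots> = fps_of_poly ((1 - monom 1 1) * (1 - monom 1 (a * n)) * (semigroup_poly T \<circ>\<^sub>p monom 1 a))"
    by (simp only: T fps_of_poly_mult fps_of_poly_diff fps_of_poly_monom' fps_of_poly_1 mult_ac power_one_right)
  finally show ?thesis by (simp only: fps_of_poly_eq_iff)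
qed

section \<open>Evaluation of the gluing identity at -1\<close>

lemma one_minus_monom_mult:
  "1 - monom (1::real) (m * k) = (1 - monom 1 m) * (\<Sum>i<k. monom 1 (m * i))"
  using one_diff_power_eq[of "monom (1::real) m" k] by (simp add: monom_power)

lemma one_minus_monom_neq_0: "m > 0 \<Longrightarrow> 1 - monom (1::real) m \<noteq> 0"
proof
  assume "m > 0" "1 - monom (1::real) m = 0"
  then have "coeff (1 - monom (1::real) m) 0 = 0" by simp
  with \<open>m > 0\<close> show False by simp
qed

lemma poly_semigroup_poly_gluing:
  assumes "a > 0" "n > 0" "coprime a n" "finite (gaps T)" "\<forall>t\<in>T. t + n \<in> T"
  shows "poly (semigroup_poly (gluing a n T)) (-1) =
    (if even a then n else if even n then a * poly (semigroup_poly T) (-1)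
     else poly (semigroup_poly T) (-1))"
proof -
  let ?P = "semigroup_poly (gluing a n T)" and ?R = "semigroup_poly T \<circ>\<^sub>p monom 1 a"
  note eq = semigroup_poly_gluing[OF assms]
  show ?thesis
  proof (cases "even a")
    case True
    \<comment> \<open>For even \<open>a\<close> the factor 1 - x^a vanishes at -1 and is cancelled
      first. Then each of the \<open>n\<close> summands is 1, \<open>?R\<close> becomes the value of
      the polynomial of \<open>T\<close> at 1, and since \<open>n\<close> is odd the factors 1 - x^n
      and 1 - x both equal 2.\<close>
    have "(1 - monom 1 a) * (?P * (1 - monom 1 n)) =
        (1 - monom 1 a) * ((1 - monom 1 1) * (\<Sum>i<n. monom 1 (a * i)) * ?R)"
      using eq one_minus_monom_mult[of a n] by (simp add: mult_ac)
    then have "?P * (1 - monom 1 n) = (1 - monom 1 1) * (\<Sum>i<n. monom 1 (a * i)) * ?R"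
      using one_minus_monom_neq_0[OF assms(1)] by (subst (asm) mult_cancel_left) simp
    then have "poly (?P * (1 - monom 1 n)) (-1) =
        poly ((1 - monom 1 1) * (\<Sum>i<n. monom 1 (a * i)) * ?R) (-1)" by simp
    moreover have "odd n" using True assms(3) coprime_common_divisor[of a n 2] by auto
    ultimately show ?thesis
      using True by (simp add: poly_monom poly_sum poly_pcompose poly_semigroup_poly_1)
  next
    case False
    \<comment> \<open>For odd \<open>a\<close> it is 1 - x^n that may vanish. After its cancellation
      1 - x^a and 1 - x both equal 2 at -1, and \<open>?R\<close> takes the value of the polynomial
      of \<open>T\<close> at -1.\<close>
    have "(1 - monom 1 n) * (?P * (1 - monom 1 a)) =
        (1 - monom 1 n) * ((1 - monom 1 1) * (\<Sum>i<a. monom 1 (n * i)) * ?R)"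
      using eq one_minus_monom_mult[of n a] by (simp add: mult_ac)
    then have "?P * (1 - monom 1 a) = (1 - monom 1 1) * (\<Sum>i<a. monom 1 (n * i)) * ?R"
      using one_minus_monom_neq_0[OF assms(2)] by (subst (asm) mult_cancel_left) simp
    then have *: "poly (?P * (1 - monom 1 a)) (-1) =
        poly ((1 - monom 1 1) * (\<Sum>i<a. monom 1 (n * i)) * ?R) (-1)" by simp
    have "(\<Sum>i<a. (-1::real) ^ (n * i)) = (if even n then a else 1)"
    proof (cases "even n")
      case odd: False
      have "(\<Sum>i<a. (-1::real) ^ (n * i)) = (\<Sum>i<a. (-1) ^ i)"
        using odd by (simp add: power_mult)
      also have "2 * \<dots> = 2"
        using one_diff_power_eq[of "-1::real" a] False by simp
      finally show ?thesis using odd by simp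
    qed simp
    with * show ?thesis
      using False by (simp add: poly_monom poly_sum poly_pcompose)
  qed
qed

section \<open>Compound semigroups as iterated gluings\<close>

lemma generated_monoid_compound_seq_Suc:
  assumes "\<And>i. i \<in> {1..Suc p} \<Longrightarrow> 0 < a i"
  shows "generated_monoid (Suc p) (compound_seq (Suc p) a b) =
    gluing (a (Suc p)) (\<Prod>i=1..Suc p. b i) (generated_monoid p (compound_seq p a b))"
    (is "_ = gluing ?a ?n ?T")
proof -
  have lower: "compound_seq (Suc p) a b i = ?a * compound_seq p a b i" if "i \<le> p" for i
    using that assms by (subst (1 2) compound_seq_closed_form) (auto simp: mult_ac)
  have last: "compound_seq (Suc p) a b (Suc p) = ?n"
    using assms by (subst compound_seq_closed_form) auto
  have sum: "(\<Sum>i=0..Suc p. c i * compound_seq (Suc p) a b i) =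
      ?a * (\<Sum>i=0..p. c i * compound_seq p a b i) + ?n * c (Suc p)" for c
    unfolding sum.atLeast0_atMost_Suc last
    by (simp add: lower sum_distrib_left mult_ac)
  show ?thesis
  proof (intro equalityI subsetI)
    fix x assume "x \<in> generated_monoid (Suc p) (compound_seq (Suc p) a b)"
    then show "x \<in> gluing ?a ?n ?T"
      unfolding generated_monoid_def gluing_def sum by blast
  next
    fix x assume "x \<in> gluing ?a ?n ?T"
    then obtain c d where "x = ?a * (\<Sum>i=0..p. c i * compound_seq p a b i) + ?n * d"
      unfolding generated_monoid_def gluing_def by blast
    also have "\<dots> = (\<Sum>i=0..Suc p. (c(Suc p := d)) i * compound_seq (Suc p) a b i)"
      unfolding sum by simp
    finally show "x \<in> generated_monoid (Suc p) (compound_seq (Suc p) a b)"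
      unfolding generated_monoid_def by blast
  qed
qed

text \<open>Supplies the closure hypothesis on \<open>T\<close> in the gluing lemmas, where
  \<open>n\<close> is a multiple of the last generator of \<open>T\<close>.\<close>

lemma generated_monoid_add_multiple:
  assumes "t \<in> generated_monoid p f" "j \<le> p"
  shows "t + m * f j \<in> generated_monoid p f"
proof -
  obtain c where "t = (\<Sum>i=0..p. c i * f i)" using assms(1) unfolding generated_monoid_def by auto
  then have "t + m * f j = (\<Sum>i=0..p. (c i + (if i = j then m else 0)) * f i)"
    using assms(2) by (simp add: add_mult_distrib sum.distrib if_distrib[of "\<lambda>u. u * _"] cong: if_cong)
  then show ?thesis unfolding generated_monoid_def by (intro CollectI exI)
qed

section \<open>Recursion of \<open>m2\<close> and \<open>M2\<close> in the length of the
  sequence\<close>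

lemma m2_le: "m2 p z \<le> Suc p"
  unfolding m2_def by simp

lemma m2_eq_Suc_iff: "m2 p z = Suc p \<longleftrightarrow> (\<forall>i\<in>{1..p}. odd (z i))"
proof -
  have "m2 p z = Suc p \<longleftrightarrow> Suc p \<le> m2 p z" using m2_le[of p z] by auto
  also have "\<dots> \<longleftrightarrow> (\<forall>i\<in>{1..p}. odd (z i))"
    unfolding m2_def by (subst Min_ge_iff) (auto simp: not_less_eq_eq[symmetric])
  finally show ?thesis .
qed

text \<open>The first even entry either has index at most \<open>p\<close>, and then is the same for
  both lengths, or has index \<open>Suc p\<close>, which is the default value of
  \<open>m2 p z\<close>.\<close>

lemma m2_Suc:
  assumes "m2 (Suc p) z \<noteq> Suc (Suc p)"
  shows "m2 (Suc p) z = m2 p z"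
proof -
  let ?A = "\<lambda>p. {i. 1 \<le> i \<and> i \<le> p \<and> even (z i)} \<union> {p + 1}"
  have fin: "finite (?A p)" for p by simp
  have Min_in_A: "m2 p z \<in> ?A p" for p unfolding m2_def using Min_in[OF fin] by blast
  have "m2 (Suc p) z \<in> ?A p"
    using Min_in_A[of "Suc p"] assms by (auto simp: le_Suc_eq)
  then have le: "m2 p z \<le> m2 (Suc p) z" unfolding m2_def[of p] using Min_le[OF fin] by blast
  have "m2 (Suc p) z \<le> m2 p z"
  proof (cases "m2 p z = Suc p")
    case True
    then show ?thesis using m2_le[of "Suc p" z] assms by simp
  next
    case False
    then have "m2 p z \<in> ?A (Suc p)" using Min_in_A[of p] by auto
    then show ?thesis unfolding m2_def[of "Suc p"] using Min_le[OF fin] by blast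
  qed
  with le show ?thesis by simp
qed

lemma M2_Suc: "M2 (Suc p) z = (if even (z (Suc p)) then Suc p else M2 p z)"
proof (cases "even (z (Suc p))")
  case True
  then show ?thesis unfolding M2_def by (auto intro!: Max_eqI)
next
  case False
  then have "{i. 1 \<le> i \<and> i \<le> Suc p \<and> even (z i)} = {i. 1 \<le> i \<and> i \<le> p \<and> even (z i)}"
    by (auto simp: le_Suc_eq)
  with False show ?thesis unfolding M2_def by simp
qed

section \<open>Induction on the length of the compound sequence\<close>

lemma poly_semigroup_poly_compound:
  assumes "\<And>i. i \<in> {1..p} \<Longrightarrow> 0 < a i" "\<And>i. i \<in> {1..p} \<Longrightarrow> 0 < b i" "suitable_pair p a b"
  defines "S \<equiv> generated_monoid p (compound_seq p a b)"
  shows "finite (gaps S) \<and>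
    poly (semigroup_poly S) (-1) = real (\<Prod>i=m2 p b..p. a i) * real (\<Prod>i=1..M2 p a. b i)"
  using assms(1-3) unfolding S_def
proof (induction p)
  case 0
  \<comment> \<open>The only generator is the empty product 1, and both products on the right-hand
    side are empty.\<close>
  have "generated_monoid 0 (compound_seq 0 a b) = UNIV"
    by (auto simp: generated_monoid_def)
  moreover have "M2 0 a = 0" unfolding M2_def by (rule Max_eqI) auto
  moreover have "m2 0 b = 1" unfolding m2_def by (rule Min_eqI) auto
  ultimately show ?case by (simp add: gaps_def semigroup_poly_def)
next
  case (Suc p)
  let ?T = "generated_monoid p (compound_seq p a b)"
  define n where "n = (\<Prod>i=1..Suc p. b i)"
  have "suitable_pair p a b" using Suc.prems(3) by (auto simp: suitable_pair_def)
  with Suc have IH: "finite (gaps ?T)"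
      "poly (semigroup_poly ?T) (-1) = real (\<Prod>i=m2 p b..p. a i) * real (\<Prod>i=1..M2 p a. b i)"
    by auto
  have a: "a (Suc p) > 0" using Suc.prems(1) by simp
  have n: "n > 0" unfolding n_def using Suc.prems(2) by (intro prod_pos) auto
  have cop: "coprime (a (Suc p)) n"
    unfolding n_def using Suc.prems(3)
    by (intro prod_coprime_right) (auto simp: suitable_pair_def coprime_iff_gcd_eq_1)
  have "n = b (Suc p) * compound_seq p a b p"
    unfolding n_def using Suc.prems(1) by (subst compound_seq_closed_form) auto
  then have closed: "\<forall>t\<in>?T. t + n \<in> ?T"
    using generated_monoid_add_multiple by simp
  have odd_n: "odd n \<longleftrightarrow> m2 (Suc p) b = Suc (Suc p)"
    unfolding n_def m2_eq_Suc_iff by (subst even_prod_iff) auto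
  have S: "generated_monoid (Suc p) (compound_seq (Suc p) a b) = gluing (a (Suc p)) n ?T"
    unfolding n_def using Suc.prems(1) by (rule generated_monoid_compound_seq_Suc)
  note poly_S = poly_semigroup_poly_gluing[OF a n cop IH(1) closed]
  have "poly (semigroup_poly (gluing (a (Suc p)) n ?T)) (-1) =
    real (\<Prod>i=m2 (Suc p) b..Suc p. a i) * real (\<Prod>i=1..M2 (Suc p) a. b i)"
  proof (cases "odd n")
    case True
    \<comment> \<open>All \<open>b i\<close> are odd, so the product of the \<open>a i\<close> is
      empty for both lengths. An even last \<open>a\<close> makes the product of the
      \<open>b i\<close> equal to \<open>n\<close>; an odd one leaves it unchanged.\<close>
    then have "m2 (Suc p) b = Suc (Suc p)" "m2 p b = Suc p"
      using odd_n unfolding m2_eq_Suc_iff by auto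
    then show ?thesis
      using True unfolding poly_S IH(2) by (cases "even (a (Suc p))") (simp_all add: M2_Suc n_def)
  next
    case False
    then have "odd (a (Suc p))"
      using cop coprime_common_divisor[of "a (Suc p)" n 2] by auto
    \<comment> \<open>Since \<open>m2 p b\<close> is at most \<open>Suc p\<close>, the range always
      gains the index \<open>Suc p\<close>, even if it was empty before.\<close>
    moreover have "(\<Prod>i=m2 (Suc p) b..Suc p. a i) = (\<Prod>i=m2 p b..p. a i) * a (Suc p)"
      using False odd_n m2_le[of p b] by (simp add: m2_Suc)
    ultimately show ?thesis
      using False unfolding poly_S IH(2) by (simp add: M2_Suc)
  qed
  then show ?case unfolding S using finite_gaps_gluing[OF a cop IH(1)] by blast
qed

theorem corollary3p11:
  fixes p :: nat and a b :: "nat \<Rightarrow> nat" and S :: "nat set" and \<alpha> \<beta> :: nat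
  assumes "\<And>i. i \<in> {1..p} \<Longrightarrow> 0 < a i"
    and "\<And>i. i \<in> {1..p} \<Longrightarrow> 0 < b i"
    and "suitable_pair p a b"
  defines "S \<equiv> generated_monoid p (compound_seq p a b)"
    and "\<alpha> \<equiv> (\<Prod>i=m2 p b..p. a i)"
    and "\<beta> \<equiv> (\<Prod>i=1..M2 p a. b i)"
  shows "real (num_odd (gaps S)) - real (num_even (gaps S)) = (real \<alpha> * real \<beta> - 1) / 2"
proof -
  have "finite (gaps S)" "poly (semigroup_poly S) (-1) = real \<alpha> * real \<beta>"
    using poly_semigroup_poly_compound[OF assms(1-3)] unfolding S_def \<alpha>_def \<beta>_def by blast+
  with poly_semigroup_poly_minus_1[of S] show ?thesis by argo
qed

end
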